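(* Let $v\in\mathbb{R}_{\ge0}^{2^{[N]}}$ be a nonzero irreducible balanced vector with complexity $m$. Then $$m\le\max_{A\in\{0,1\}^{N\times N}}\det A\le\frac{(N+1)^{(N+1)/2}}{2^N}.$$
   Context: For $I\subseteq[N]$, $1_I\in\mathbb{R}^N$ is the indicator vector of $I$, and $B_N$ is the $N\times2^N$ matrix with columns $1_I$ for $I\subseteq[N]$. A vector $v\in\mathbb{R}_{\ge0}^{2^{[N]}}$ is balanced if $B_Nv=m1_{[N]}$ for some $m\in\mathbb{R}$. A balanced vector $v$ is irreducible if whenever $v=u_1+u_2$ with $u_1,u_2$ balanced, both are real multiples of $v$. The complexity of a nonzero balanced vector $v$ (whose entries are rational up to scaling) is the value $m$ with $B_Nv'=m1_{[N]}$, where $v'$ is the positive multiple of $v$ whose entries are integers with no common factor. *)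

theory Defs
  imports "HOL-Analysis.Analysis"
begin

(* The index set [N] is a finite type 'n with N = CARD('n) (so N >= 1), and
   the space R^(2^[N]) is real ^ 'n set. *)

definition ind_vec :: "'n::finite set \<Rightarrow> real ^ 'n" where
  "ind_vec I = (\<chi> i. indicator I i)"

definition incidence_matrix :: "real ^ ('n::finite set) ^ 'n" where
  "incidence_matrix = (\<chi> i I. ind_vec I $ i)"

definition balanced :: "real ^ ('n::finite set) \<Rightarrow> bool" where
  "balanced v \<longleftrightarrow>
     (\<forall>I. 0 \<le> v $ I) \<and> (\<exists>m. incidence_matrix *v v = m *\<^sub>R ind_vec UNIV)"

definition irreducible_balanced :: "real ^ ('n::finite set) \<Rightarrow> bool" where
  "irreducible_balanced v \<longleftrightarrow>
     balanced v \<and>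
     (\<forall>u\<^sub>1 u\<^sub>2. balanced u\<^sub>1 \<and> balanced u\<^sub>2 \<and> v = u\<^sub>1 + u\<^sub>2 \<longrightarrow>
        (\<exists>a. u\<^sub>1 = a *\<^sub>R v) \<and> (\<exists>b. u\<^sub>2 = b *\<^sub>R v))"

definition primitive_integral :: "real ^ 'a::finite \<Rightarrow> bool" where
  "primitive_integral w \<longleftrightarrow>
     (\<exists>z :: 'a \<Rightarrow> int. (\<forall>i. w $ i = of_int (z i)) \<and> Gcd (range z) = 1)"

(* Meaningful only for nonzero vectors whose entries are rational up to
   scaling; for these the positive multiple exists and is unique. *)
definition primitive_multiple :: "real ^ 'a::finite \<Rightarrow> real ^ 'a" where
  "primitive_multiple v = (THE w. primitive_integral w \<and> (\<exists>c>0. w = c *\<^sub>R v))"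

definition complexity :: "real ^ ('n::finite set) \<Rightarrow> real" where
  "complexity v =
     (THE m. incidence_matrix *v primitive_multiple v = m *\<^sub>R ind_vec UNIV)"

definition zero_one_matrices :: "(real ^ 'n::finite ^ 'n) set" where
  "zero_one_matrices = {A. \<forall>i j. A $ i $ j \<in> {0, 1}}"

end

theory Submission
  imports Defs
begin

text \<open>Let the irreducible balanced vector \<open>v\<close> have row sum \<open>\<mu> > 0\<close>; if \<open>\<mu> = 0\<close>, then \<open>v\<close> is supported on the
  empty set and has complexity 0. By irreducibility the indicator vectors of the sets in the
  support of \<open>v\<close> are linearly independent, and they can be completed to a basis by further indicator
  vectors. The basis vectors are the columns of an invertible 0/1 matrix \<open>A\<close>, and by Cramer's rule
  \<open>(\<bar>det A\<bar> / \<mu>) v\<close> is integral. Its row sum is \<open>\<bar>det A\<bar>\<close>, so the primitive multiple has row sum at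
  most \<open>\<bar>det A\<bar>\<close>. The bound on determinants of 0/1 matrices is Hadamard's inequality applied after
  multiplication by a square root of \<open>I - J / (N + 1)\<close>, where \<open>J\<close> is the all-ones matrix.\<close>

section \<open>Determinants of 0/1 matrices\<close>

text \<open>The rows in \<^term>\<open>S\<close> are those already orthogonalised. Replacing a further row by its component
  orthogonal to all other rows keeps the determinant and does not increase the norm.\<close>

lemma hadamard_inequality_orthogonal_rows:
  fixes A :: "real ^ 'n ^ 'n"
  assumes "\<And>i j. i \<in> S \<Longrightarrow> j \<noteq> i \<Longrightarrow> row i A \<bullet> row j A = 0"
  shows "\<bar>det A\<bar> \<le> (\<Prod>i\<in>UNIV. norm (row i A))"
  using assms
proof (induction "card (- S)" arbitrary: S A)
  case 0
  then have "S = UNIV" by auto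
  with 0 have orth: "row i A \<bullet> row j A = 0" if "j \<noteq> i" for i j
    using that by auto
  have entry: "(A ** transpose A) $ i $ j = row i A \<bullet> row j A" for i j
    by (simp add: matrix_matrix_mult_def transpose_def row_def inner_vec_def)
  \<comment> \<open>All rows are now orthogonal, so the Gram matrix is diagonal and its determinant
    is the product of the squared row norms.\<close>
  have "(det A)\<^sup>2 = det (A ** transpose A)"
    by (simp add: det_mul power2_eq_square)
  also have "\<dots> = (\<Prod>i\<in>UNIV. (A ** transpose A) $ i $ i)"
    by (rule det_diagonal) (use entry orth in auto)
  also have "\<dots> = (\<Prod>i\<in>UNIV. norm (row i A))\<^sup>2"
    by (simp add: entry power2_norm_eq_inner prod_power_distrib)
  finally have "\<bar>det A\<bar> = \<bar>\<Prod>i\<in>UNIV. norm (row i A)\<bar>"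
    by (metis real_sqrt_abs)
  then show ?case by (simp add: prod_nonneg)
next
  case (Suc n)
  then have "- S \<noteq> {}" by (metis card.empty nat.simps(3))
  then obtain i where i: "i \<notin> S" by blast
  obtain y z where y: "y \<in> span {row j A | j. j \<noteq> i}"
    and z: "\<And>w. w \<in> span {row j A | j. j \<noteq> i} \<Longrightarrow> orthogonal z w"
    and yz: "row i A = y + z"
    by (rule orthogonal_subspace_decomp_exists[where S = "{row j A | j. j \<noteq> i}" and x = "row i A"]) blast
  define B where "B = (\<chi> k. if k = i then row i A + - y else row k A)"
  have rowi: "row i B = z" and rowk: "\<And>k. k \<noteq> i \<Longrightarrow> row k B = row k A"
    using yz by (auto simp: B_def row_def vec_eq_iff)
  have "- y \<in> vec.span {row j A | j. j \<noteq> i}"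
    using y by (simp add: span_vec_eq span_neg)
  then have "det B = det A"
    unfolding B_def by (rule det_row_span)
  have orth: "z \<bullet> row j A = 0" if "j \<noteq> i" for j
    using z[of "row j A"] that by (auto simp: orthogonal_def intro: span_base)
  have "\<bar>det B\<bar> \<le> (\<Prod>k\<in>UNIV. norm (row k B))"
  proof (rule Suc.hyps(1)[where S = "insert i S"])
    have "- insert i S = - S - {i}" by auto
    then show "n = card (- insert i S)"
      using Suc.hyps(2) i by simp
    show "row k B \<bullet> row j B = 0" if "k \<in> insert i S" "j \<noteq> k" for k j
    proof (cases "k = i")
      case True
      then show ?thesis using that orth by (simp add: rowi rowk)
    next
      case False
      then show ?thesis
        using that orth Suc.prems[of k j] by (cases "j = i") (auto simp: rowi rowk inner_commute)
    qed
  qed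
  also have "\<dots> \<le> (\<Prod>k\<in>UNIV. norm (row k A))"
  proof (rule prod_mono)
    fix k
    have "orthogonal z y" using z y by blast
    then have "(norm (y + z))\<^sup>2 = (norm y)\<^sup>2 + (norm z)\<^sup>2"
      by (intro norm_add_Pythagorean) (simp add: orthogonal_commute)
    then have "(norm z)\<^sup>2 \<le> (norm (row i A))\<^sup>2"
      by (simp only: yz) simp
    then have "norm z \<le> norm (row i A)"
      by (rule power2_le_imp_le) simp
    then show "0 \<le> norm (row k B) \<and> norm (row k B) \<le> norm (row k A)"
      by (cases "k = i") (auto simp: rowi rowk)
  qed
  finally show ?case by (simp add: \<open>det B = det A\<close>)
qed

lemma hadamard_inequality:
  fixes A :: "real ^ 'n ^ 'n"
  shows "\<bar>det A\<bar> \<le> (\<Prod>i\<in>UNIV. norm (row i A))"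
  using hadamard_inequality_orthogonal_rows[of "{}" A] by simp

text \<open>Row \<open>i\<close> is \<open>w\<close> itself, so subtracting multiples of it clears
  the \<open>w\<close> parts of the other rows and leaves the identity with row \<open>i\<close>
  replaced. Such determinants arise when a rank-one update is expanded in one row.\<close>

lemma det_replace_row_add_multiples:
  fixes u :: "'n::finite \<Rightarrow> 'a::field" and w :: "'a ^ 'n"
  assumes "finite S" "i \<notin> S"
  shows "det (\<chi> k. if k = i then w else if k \<in> S then axis k 1 + u k *s w else axis k 1) = w $ i"
  using assms
proof (induction S)
  case empty
  have rows: "row k (mat 1 :: 'a ^ 'n ^ 'n) = axis k 1" for k
    by (auto simp: vec_eq_iff row_def mat_def axis_def)
  \<comment> \<open>Cramer's lemma for the identity matrix: \<open>w\<close> combines the unit rows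
    with its own coordinates as coefficients.\<close>
  show ?case
    using cramer_lemma_transpose[of i w "mat 1 :: 'a ^ 'n ^ 'n"]
    by (simp add: rows basis_expansion cong: if_cong)
next
  case (insert j S)
  let ?D = "\<chi> k. if k = i then w else if k \<in> S then axis k 1 + u k *s w else axis k (1::'a)"
  from insert have ij: "i \<noteq> j" and iS: "i \<notin> S" and jS: "j \<notin> S" by auto
  have "row i ?D = w" "row j ?D = axis j 1"
    using ij jS by (simp_all add: row_def)
  then have "(\<chi> k. if k = j then row j ?D + u j *s row i ?D else row k ?D)
    = (\<chi> k. if k = i then w else if k \<in> insert j S then axis k 1 + u k *s w else axis k 1)"
    using ij jS by (auto simp: vec_eq_iff row_def)
  then show ?case
    using det_row_operation[of j i ?D "u j"] ij insert.IH iS by simp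
qed

text \<open>The matrix determinant lemma, with the update switched on one row at a time: the
  determinant is additive in the new row \<open>i\<close>, and the extra summand is
  \<open>u i * w $ i\<close>. Below it gives \<open>det Q\<close>.\<close>

lemma det_rank_one_update_rows:
  fixes u :: "'n::finite \<Rightarrow> 'a::field" and w :: "'a ^ 'n"
  assumes "finite S"
  shows "det (\<chi> k. if k \<in> S then axis k 1 + u k *s w else axis k 1) = 1 + (\<Sum>k\<in>S. u k * w $ k)"
  using assms
proof (induction S)
  case empty
  have "(\<chi> k. axis k 1) = (mat 1 :: 'a ^ 'n ^ 'n)"
    by (auto simp: vec_eq_iff axis_def mat_def)
  then show ?case by simp
next
  case (insert i S)
  let ?c = "\<lambda>k. if k \<in> S then axis k 1 + u k *s w else axis k (1::'a)"
  have "(\<chi> k. if k \<in> insert i S then axis k 1 + u k *s w else axis k 1)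
      = (\<chi> k. if k = i then axis i 1 + u i *s w else ?c k)"
    by (auto simp: vec_eq_iff)
  moreover have "det (\<chi> k. if k = i then axis i 1 + u i *s w else ?c k)
      = det (\<chi> k. if k = i then axis i 1 else ?c k) + u i * det (\<chi> k. if k = i then w else ?c k)"
    using det_row_add[of i "\<lambda>_. axis i 1" "\<lambda>_. u i *s w" ?c] det_row_mul[of i "u i" "\<lambda>_. w" ?c] by simp
  moreover have "(\<chi> k. if k = i then axis i 1 else ?c k) = (\<chi> k. ?c k)"
    using insert.hyps by (auto simp: vec_eq_iff)
  ultimately show ?case
    using insert det_replace_row_add_multiples[of S i w u] by (simp add: add_ac)
qed

text \<open>The matrix \<open>Q = I - c J\<close> below, \<open>J\<close> being the all-ones matrix, satisfies \<open>Q Q\<^sup>T = I - J / (N + 1)\<close>.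
  A 0/1 row with \<open>s\<close> ones thus becomes a row of squared norm \<open>s - s\<^sup>2 / (N + 1) \<le> (N + 1) / 4\<close>.\<close>

lemma zero_one_matrix_det_bound:
  fixes A :: "real ^ 'n::finite ^ 'n"
  assumes "A \<in> zero_one_matrices"
  shows "\<bar>det A\<bar> \<le> (real CARD('n) + 1) powr ((real CARD('n) + 1) / 2) / 2 ^ CARD('n)"
proof -
  define N where "N = real CARD('n)"
  define t where "t = 1 / sqrt (N + 1)"
  \<comment> \<open>The product of \<open>Q\<close> with its transpose is
    \<open>I - (2 * c - c^2 * N) J\<close>, so \<open>c\<close> must solve
    \<open>2 * c - c^2 * N = 1 / (N + 1)\<close>. The roots are \<open>(1 - t) / N\<close> and
    \<open>(1 + t) / N\<close>; the smaller one makes \<open>det Q = 1 - c * N = t\<close>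
    positive.\<close>
  define c where "c = (1 - t) / N"
  define Q :: "real ^ 'n ^ 'n" where "Q = (\<chi> k. axis k 1 + (- c) *s 1)"
  define s where "s = (\<lambda>i. \<Sum>j\<in>UNIV. A $ i $ j)"
  have N: "N > 0" by (simp add: N_def)
  then have t: "t > 0" "t\<^sup>2 = 1 / (N + 1)" by (auto simp: t_def power_divide)
  have detQ: "det Q = t"
    using det_rank_one_update_rows[of UNIV "\<lambda>_. - c" "1 :: real ^ 'n"] N
    by (simp add: Q_def c_def flip: N_def)
  have entry: "(A ** Q) $ i $ j = A $ i $ j - c * s i" for i j
  proof -
    have "Q $ k $ j = (if k = j then 1 else 0) - c" for k
      by (simp add: Q_def axis_def)
    then have "(A ** Q) $ i $ j = (\<Sum>k\<in>UNIV. A $ i $ k * ((if k = j then 1 else 0) - c))"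
      by (simp add: matrix_matrix_mult_def)
    also have "\<dots> = (\<Sum>k\<in>UNIV. (if k = j then A $ i $ k else 0) - c * A $ i $ k)"
      by (intro sum.cong) (auto simp: algebra_simps)
    also have "\<dots> = A $ i $ j - c * s i"
      by (simp add: sum_subtractf s_def sum_distrib_left)
    finally show ?thesis .
  qed
  have "2 * c - c\<^sup>2 * N = (1 - t\<^sup>2) / N"
    using N by (simp add: c_def field_simps power2_eq_square)
  also have "\<dots> = 1 / (N + 1)"
    unfolding t(2) using N by (simp add: divide_simps)
  finally have c: "2 * c - c\<^sup>2 * N = 1 / (N + 1)" .
  have row_bound: "norm (row i (A ** Q)) \<le> sqrt ((N + 1) / 4)" for i
  proof -
    have sq: "(A $ i $ j)\<^sup>2 = A $ i $ j" for j
    proof -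
      have "A $ i $ j \<in> {0, 1}" using assms by (simp add: zero_one_matrices_def)
      then show ?thesis by auto
    qed
    have sum1: "sum (($) (A $ i)) UNIV = s i" by (simp add: s_def)
    have scaled_sum: "(\<Sum>j\<in>UNIV. x * A $ i $ j) = x * s i" for x
      by (simp add: s_def sum_distrib_left)
    have "(norm (row i (A ** Q)))\<^sup>2 = (\<Sum>j\<in>UNIV. (A $ i $ j - c * s i)\<^sup>2)"
      by (simp add: norm_vec_def L2_set_def row_def entry sum_nonneg)
    also have "\<dots> = (\<Sum>j\<in>UNIV. A $ i $ j - 2 * c * s i * A $ i $ j + (c * s i)\<^sup>2)"
      by (intro sum.cong refl) (simp add: power2_diff sq)
    also have "\<dots> = s i - 2 * c * s i * s i + N * (c * s i)\<^sup>2"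
      by (simp add: sum.distrib sum_subtractf N_def scaled_sum sum1)
    also have "\<dots> = s i - (2 * c - c\<^sup>2 * N) * (s i)\<^sup>2"
      by (simp add: power2_eq_square algebra_simps)
    also have "\<dots> = s i - 1 / (N + 1) * (s i)\<^sup>2"
      by (simp only: c)
    \<comment> \<open>Complete the square in \<open>s i\<close>.\<close>
    also have "\<dots> = (N + 1) / 4 - (s i - (N + 1) / 2)\<^sup>2 / (N + 1)"
      using N by (simp add: field_simps power2_eq_square)
    also have "\<dots> \<le> (N + 1) / 4"
    proof -
      have "0 \<le> (s i - (N + 1) / 2)\<^sup>2 / (N + 1)" using N by simp
      then show ?thesis by linarith
    qed
    finally show ?thesis
      by (rule real_le_rsqrt)
  qed
  have "\<bar>det A\<bar> * t = \<bar>det (A ** Q)\<bar>"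
    using t by (simp add: det_mul detQ abs_mult)
  also have "\<dots> \<le> (\<Prod>i\<in>UNIV. norm (row i (A ** Q)))"
    by (rule hadamard_inequality)
  also have "\<dots> \<le> (\<Prod>i\<in>(UNIV :: 'n set). sqrt ((N + 1) / 4))"
    by (intro prod_mono) (simp add: row_bound)
  also have "\<dots> = sqrt (N + 1) ^ CARD('n) / 2 ^ CARD('n)"
    by (simp add: real_sqrt_divide power_divide)
  \<comment> \<open>Dividing by \<open>t\<close> contributes one more factor
    \<open>sqrt (N + 1)\<close>.\<close>
  finally have bound: "\<bar>det A\<bar> \<le> sqrt (N + 1) ^ (CARD('n) + 1) / 2 ^ CARD('n)"
    using N by (simp add: t_def field_simps)
  have "sqrt (N + 1) ^ (CARD('n) + 1) = sqrt (N + 1) powr real (CARD('n) + 1)"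
    using N by (intro powr_realpow[symmetric]) simp
  also have "\<dots> = ((N + 1) powr (1 / 2)) powr (N + 1)"
    using N by (simp add: powr_half_sqrt N_def add.commute)
  also have "\<dots> = (N + 1) powr ((N + 1) / 2)"
    by (simp add: powr_powr)
  finally have "sqrt (N + 1) ^ (CARD('n) + 1) = (N + 1) powr ((N + 1) / 2)" .
  with bound show ?thesis by (simp only: N_def)
qed

lemma finite_zero_one_matrices: "finite (zero_one_matrices :: (real ^ 'n::finite ^ 'n) set)"
proof (rule finite_subset)
  show "zero_one_matrices \<subseteq> range (\<lambda>E :: ('n \<times> 'n) set. \<chi> i j. indicator E (i, j))"
  proof
    fix A :: "real ^ 'n ^ 'n"
    assume "A \<in> zero_one_matrices"
    then have "A = (\<chi> i j. indicator {(i, j). A $ i $ j = 1} (i, j))"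
      by (auto simp: vec_eq_iff zero_one_matrices_def indicator_def)
    then show "A \<in> range (\<lambda>E. \<chi> i j. indicator E (i, j))" by blast
  qed
qed simp

text \<open>A negative determinant changes sign when two rows are swapped, which keeps the entries
  in {0, 1}. If there are no two distinct rows, the determinant is the single entry and hence
  nonnegative.\<close>

lemma zero_one_matrix_abs_det_le_Max:
  fixes A :: "real ^ 'n::finite ^ 'n"
  assumes "A \<in> zero_one_matrices"
  shows "\<bar>det A\<bar> \<le> Max (det ` (zero_one_matrices :: (real ^ 'n ^ 'n) set))"
proof -
  have "\<exists>B \<in> (zero_one_matrices :: (real ^ 'n ^ 'n) set). \<bar>det A\<bar> = det B"
  proof (cases "det A \<ge> 0")
    case True
    then show ?thesis using assms by (intro bexI[of _ A]) simp_all
  next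
    case False
    have "\<exists>i j :: 'n. i \<noteq> j"
    proof (rule ccontr)
      assume "\<not> ?thesis"
      then have "det A = (\<Prod>i\<in>UNIV. A $ i $ i)" by (intro det_diagonal) auto
      also have "\<dots> \<ge> 0"
      proof (rule prod_nonneg)
        fix i
        have "A $ i $ i \<in> {0, 1}" using assms by (simp add: zero_one_matrices_def)
        then show "0 \<le> A $ i $ i" by auto
      qed
      finally show False using False by simp
    qed
    then obtain i j :: 'n where ij: "i \<noteq> j" by blast
    have "det (\<chi> k. A $ Transposition.transpose i j k) = - det A"
      using ij by (subst det_permute_rows) (auto simp: permutes_swap_id sign_swap_id)
    moreover have "(\<chi> k. A $ Transposition.transpose i j k) \<in> zero_one_matrices"
      using assms by (simp add: zero_one_matrices_def)
    ultimately show ?thesis using False by force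
  qed
  then show ?thesis
    by (auto intro: Max_ge simp: finite_zero_one_matrices)
qed

lemma det_in_Ints:
  fixes A :: "real ^ 'n::finite ^ 'n"
  assumes "\<And>i j. A $ i $ j \<in> \<int>"
  shows "det A \<in> \<int>"
  unfolding det_def using assms by (intro Ints_sum Ints_mult Ints_prod Ints_of_int) auto

section \<open>Primitive multiples\<close>

lemma Gcd_range_mult:
  fixes z :: "'a \<Rightarrow> int"
  shows "Gcd (range (\<lambda>i. a * z i)) = \<bar>a\<bar> * Gcd (range z)"
  using Gcd_mult[of a "range z"] by (simp add: image_image abs_mult)

text \<open>If \<open>z\<close> and \<open>y\<close> are the two integral vectors, proportionality
  gives \<open>z i * y j = y i * z j\<close>. Taking the gcd over \<open>j\<close> yields equal
  absolute values at an index with \<open>z i \<noteq> 0\<close>.\<close>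

lemma primitive_integral_scaleR_unique:
  fixes w :: "real ^ 'a::finite"
  assumes "primitive_integral w" "primitive_integral (c *\<^sub>R w)" "c > 0"
  shows "c = 1"
proof -
  obtain z where z: "\<And>i. w $ i = of_int (z i)" "Gcd (range z) = 1"
    using assms(1) by (auto simp: primitive_integral_def)
  obtain y where y: "\<And>i. c * w $ i = of_int (y i)" "Gcd (range y) = 1"
    using assms(2) by (auto simp: primitive_integral_def)
  have "\<exists>i. z i \<noteq> 0"
  proof (rule ccontr)
    assume "\<not> ?thesis"
    then have "range z = {0}" by auto
    with z(2) show False by simp
  qed
  then obtain i where i: "z i \<noteq> 0" by blast
  have "z i * y j = y i * z j" for j
  proof -
    have "real_of_int (z i * y j) = real_of_int (y i * z j)"
      by (simp flip: y(1) z(1))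
    then show ?thesis by (simp only: of_int_eq_iff)
  qed
  then have "\<bar>z i\<bar> = \<bar>y i\<bar>"
    using Gcd_range_mult[of "z i" y] Gcd_range_mult[of "y i" z] y(2) z(2) by simp
  then have "\<bar>real_of_int (z i)\<bar> = \<bar>c * real_of_int (z i)\<bar>"
    unfolding z(1)[symmetric] y(1) unfolding z(1) by linarith
  then show "c = 1"
    using i assms(3) by (simp add: abs_mult)
qed

text \<open>Dividing the integral vector \<open>k *\<^sub>R v\<close> by the gcd
  \<open>g \<ge> 1\<close> of its entries makes it primitive, so the factor is \<open>k / g\<close>.
  Any integral multiple thus bounds the primitive one.\<close>

lemma primitive_multiple_eq_scaleR:
  fixes v :: "real ^ 'a::finite"
  assumes "v \<noteq> 0" "k > 0" "\<And>i. k * v $ i \<in> \<int>"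
  shows "\<exists>c \<le> k. primitive_multiple v = c *\<^sub>R v"
proof -
  have "\<forall>i. \<exists>n. k * v $ i = of_int n"
    using assms(3) by (auto elim: Ints_cases)
  then obtain z where z: "\<And>i. k * v $ i = of_int (z i)" by metis
  define g where "g = Gcd (range z)"
  obtain i where "v $ i \<noteq> 0" using assms(1) by (auto simp: vec_eq_iff)
  then have "z i \<noteq> 0" using z[of i] assms(2) by auto
  moreover have "g dvd z i" unfolding g_def by (intro Gcd_dvd) auto
  ultimately have "g \<noteq> 0" by auto
  have "0 \<le> g" by (simp add: g_def)
  with \<open>g \<noteq> 0\<close> have g: "g \<ge> 1" by linarith
  have div: "z i = g * (z i div g)" for i
    using Gcd_dvd[of "z i" "range z"] by (simp add: g_def)
  have "g = g * Gcd (range (\<lambda>i. z i div g))"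
    using Gcd_range_mult[of g "\<lambda>i. z i div g"] g by (simp flip: div g_def)
  then have "Gcd (range (\<lambda>i. z i div g)) = 1" using g by simp
  moreover have "((k / g) *\<^sub>R v) $ i = of_int (z i div g)" for i
  proof -
    have "k * v $ i = of_int g * of_int (z i div g)"
      unfolding z using div[of i] by (metis of_int_mult)
    then show ?thesis using g by (simp add: field_simps)
  qed
  ultimately have prim: "primitive_integral ((k / g) *\<^sub>R v)"
    by (auto simp: primitive_integral_def)
  have pos: "k / g > 0" using assms(2) g by simp
  have "primitive_multiple v = (k / g) *\<^sub>R v"
    unfolding primitive_multiple_def
  proof (rule the_equality)
    show "primitive_integral ((k / g) *\<^sub>R v) \<and> (\<exists>c>0. (k / g) *\<^sub>R v = c *\<^sub>R v)"
      using prim pos by blast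
  next
    fix w
    assume "primitive_integral w \<and> (\<exists>c>0. w = c *\<^sub>R v)"
    then obtain c where w: "primitive_integral w" "w = c *\<^sub>R v" "c > 0" by blast
    have w': "w = (c / (k / g)) *\<^sub>R ((k / g) *\<^sub>R v)"
      using assms(2) g w(2) by simp
    have "c / (k / g) = 1"
    proof (rule primitive_integral_scaleR_unique[OF prim])
      show "primitive_integral ((c / (k / g)) *\<^sub>R (k / g) *\<^sub>R v)"
        using w(1) w' by simp
      show "c / (k / g) > 0" using w(3) pos by (rule divide_pos_pos)
    qed
    with w' show "w = (k / g) *\<^sub>R v" by simp
  qed
  moreover have "k / g \<le> k" using g assms(2) by (simp add: field_simps)
  ultimately show ?thesis by blast
qed

section \<open>Irreducible balanced vectors\<close>

lemma ind_vec_inject: "ind_vec I = ind_vec J \<longleftrightarrow> I = J"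
  by (auto simp: ind_vec_def vec_eq_iff indicator_def split: if_splits)

lemma ind_vec_UNIV_nonzero: "ind_vec UNIV \<noteq> 0"
  by (simp add: ind_vec_def vec_eq_iff)

lemma incidence_matrix_mult:
  "incidence_matrix *v v = (\<Sum>I\<in>UNIV. v $ I *\<^sub>R ind_vec I)"
  by (simp add: vec_eq_iff matrix_vector_mult_def incidence_matrix_def mult.commute)

lemma complexity_eq:
  assumes "primitive_multiple v = c *\<^sub>R v" "incidence_matrix *v v = \<mu> *\<^sub>R ind_vec UNIV"
  shows "complexity v = c * \<mu>"
  unfolding complexity_def
  using assms ind_vec_UNIV_nonzero
  by (intro the_equality) (auto simp: matrix_vector_mult_scaleR)

text \<open>Irreducible vectors span extreme rays of the cone of balanced vectors, so a direction
  that stays inside the cone both ways is a multiple of the vector.\<close>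

lemma irreducible_balanced_kernel:
  fixes v w :: "real ^ ('n::finite set)"
  assumes irr: "irreducible_balanced v"
    and supp: "\<And>I. v $ I = 0 \<Longrightarrow> w $ I = 0"
    and ker: "incidence_matrix *v w = 0"
  obtains a where "w = a *\<^sub>R v"
proof -
  have nonneg: "0 \<le> v $ I" for I
    using irr by (auto simp: irreducible_balanced_def balanced_def)
  obtain \<mu> where \<mu>: "incidence_matrix *v v = \<mu> *\<^sub>R ind_vec UNIV"
    using irr by (auto simp: irreducible_balanced_def balanced_def)
  \<comment> \<open>Each quotient is a summand, which bounds \<open>w\<close> entrywise by
    \<open>K * v\<close>; the 1 keeps \<open>K\<close> positive. Indices with
    \<open>v $ I = 0\<close> contribute 0, as division by zero gives 0.\<close>
  define K where "K = 1 + (\<Sum>I\<in>UNIV. \<bar>w $ I\<bar> / v $ I)"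
  have K: "K > 0" unfolding K_def
    by (intro add_pos_nonneg sum_nonneg divide_nonneg_nonneg) (auto simp: nonneg)
  have bound: "\<bar>w $ I\<bar> \<le> K * v $ I" for I
  proof (cases "v $ I = 0")
    case False
    have "\<bar>w $ I\<bar> / v $ I \<le> (\<Sum>I\<in>UNIV. \<bar>w $ I\<bar> / v $ I)"
      by (intro member_le_sum) (auto simp: nonneg)
    then have "\<bar>w $ I\<bar> / v $ I \<le> K" by (simp add: K_def)
    then show ?thesis using False nonneg[of I] by (simp add: field_simps)
  qed (simp add: supp)
  \<comment> \<open>The halves of \<open>v\<close> pushed along \<open>w\<close> and along
    \<open>-w\<close>; \<open>K\<close> is large enough to keep both nonnegative.\<close>
  define u where "u = (\<lambda>s. (1 / 2) *\<^sub>R (v + (s / K) *\<^sub>R w))"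
  have "balanced (u s)" if "\<bar>s\<bar> = 1" for s
    unfolding balanced_def
  proof (intro conjI allI)
    fix I
    have "\<bar>s * w $ I\<bar> \<le> K * v $ I" using bound that by (simp add: abs_mult)
    then have "0 \<le> K * v $ I + s * w $ I" by linarith
    then show "0 \<le> u s $ I" using K by (simp add: u_def field_simps)
    have "incidence_matrix *v u s = (\<mu> / 2) *\<^sub>R ind_vec UNIV"
      by (simp add: u_def matrix_vector_mult_scaleR matrix_vector_right_distrib \<mu> ker)
    then show "\<exists>m. incidence_matrix *v u s = m *\<^sub>R ind_vec UNIV" ..
  qed
  then have "balanced (u 1)" "balanced (u (- 1))" by simp_all
  moreover have "v = u 1 + u (- 1)"
    by (simp add: u_def vec_eq_iff field_simps)
  ultimately obtain a where "u 1 = a *\<^sub>R v"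
    using irr unfolding irreducible_balanced_def by blast
  then have "w = (K * (2 * a - 1)) *\<^sub>R v"
    using K by (simp add: u_def vec_eq_iff field_simps)
  then show thesis by (rule that)
qed

text \<open>A linear relation on the support gives a kernel vector \<open>w\<close>, hence
  \<open>w = a *\<^sub>R v\<close>. The row sum of \<open>w\<close> is then both 0 and
  \<open>a * \<mu>\<close>, so \<open>a = 0\<close> and the relation is trivial.\<close>

lemma irreducible_balanced_independent:
  fixes v :: "real ^ ('n::finite set)"
  assumes irr: "irreducible_balanced v"
    and \<mu>: "incidence_matrix *v v = \<mu> *\<^sub>R ind_vec UNIV" "\<mu> \<noteq> 0"
  shows "independent (ind_vec ` {I. v $ I \<noteq> 0})"
proof
  assume "dependent (ind_vec ` {I. v $ I \<noteq> 0})"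
  then obtain u where u: "\<exists>I. v $ I \<noteq> 0 \<and> u (ind_vec I) \<noteq> 0"
    and sum0: "(\<Sum>x\<in>ind_vec ` {I. v $ I \<noteq> 0}. u x *\<^sub>R x) = 0"
    by (auto simp: dependent_finite)
  define w where "w = (\<chi> I. if v $ I \<noteq> 0 then u (ind_vec I) else 0)"
  have "incidence_matrix *v w = (\<Sum>I | v $ I \<noteq> 0. u (ind_vec I) *\<^sub>R ind_vec I)"
    unfolding incidence_matrix_mult by (intro sum.mono_neutral_cong_right) (auto simp: w_def)
  also have "\<dots> = 0"
    using sum0 by (subst (asm) sum.reindex) (auto simp: inj_on_def ind_vec_inject)
  finally have ker: "incidence_matrix *v w = 0" .
  then obtain a where a: "w = a *\<^sub>R v"
    using irreducible_balanced_kernel[OF irr, of w] by (auto simp: w_def)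
  then have "a * \<mu> = 0"
    using ker \<mu>(1) by (simp add: matrix_vector_mult_scaleR ind_vec_UNIV_nonzero)
  then have "w = 0" using a \<mu>(2) by simp
  moreover obtain I where I: "v $ I \<noteq> 0" "u (ind_vec I) \<noteq> 0" using u by blast
  then have "w $ I \<noteq> 0" by (simp add: w_def)
  ultimately show False by simp
qed

text \<open>Indicators of singletons are the unit vectors, so indicator vectors span the space and a
  maximal independent set of them has exactly N elements.\<close>

lemma independent_ind_vec_extend:
  fixes S :: "'n::finite set set"
  assumes "independent (ind_vec ` S :: (real ^ 'n) set)"
  obtains f :: "'n \<Rightarrow> 'n set" where "inj f" "S \<subseteq> range f"
    "det (\<chi> i j. ind_vec (f j) $ i) \<noteq> (0 :: real)"
proof -
  obtain B :: "(real ^ 'n) set" where B: "ind_vec ` S \<subseteq> B" "B \<subseteq> range ind_vec"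
    "independent B" "range ind_vec \<subseteq> span B"
    using maximal_independent_subset_extend[of "ind_vec ` S" "range ind_vec"] assms by blast
  have "axis j 1 = ind_vec {j}" for j :: 'n
    by (auto simp: vec_eq_iff axis_def ind_vec_def)
  then have "Basis \<subseteq> span B"
    using B(4) by (auto simp: Basis_vec_def)
  then have span: "span B = UNIV"
    using span_mono[of Basis "span B"] by (simp add: span_span top.extremum_unique)
  then have "card B = CARD('n)"
    using B(3) by (metis DIM_cart DIM_real dim_UNIV dim_eq_card_independent dim_span mult.right_neutral)
  moreover have "finite B" using B(3) by (rule finiteI_independent)
  ultimately obtain g where g: "bij_betw g (UNIV :: 'n set) B"
    using finite_same_card_bij[of "UNIV :: 'n set" B] by auto
  then have "\<forall>j. \<exists>I. g j = ind_vec I"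
    using B(2) by (auto simp: bij_betw_def)
  then obtain f where f: "\<And>j. g j = ind_vec (f j)" by metis
  have "inj f"
    using g f by (metis bij_betw_def injD injI)
  moreover have "S \<subseteq> range f"
  proof
    fix I assume "I \<in> S"
    then have "ind_vec I \<in> range g" using B(1) g by (auto simp: bij_betw_def)
    then show "I \<in> range f" by (auto simp: f ind_vec_inject)
  qed
  moreover have "det (\<chi> i j. ind_vec (f j) $ i) \<noteq> (0 :: real)"
  proof -
    let ?A = "(\<chi> i j. ind_vec (f j) $ i) :: real ^ 'n ^ 'n"
    have "columns ?A = B"
      using g by (auto simp: columns_def column_def bij_betw_def simp flip: f)
    then have "vec.span (columns ?A) = UNIV"
      using span by (simp add: span_vec_eq)
    then show ?thesis
      using invertible_det_nz[of ?A] invertible_right_inverse[of ?A]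
        matrix_right_invertible_span_columns[of ?A] by blast
  qed
  ultimately show thesis using that by blast
qed

text \<open>Cramer's rule for the system whose columns are the support of the vector, completed to a basis
  by further indicator vectors.\<close>

lemma irreducible_balanced_scale_integral:
  fixes v :: "real ^ ('n::finite set)"
  assumes irr: "irreducible_balanced v"
    and \<mu>: "incidence_matrix *v v = \<mu> *\<^sub>R ind_vec UNIV" "\<mu> > 0"
  shows "\<exists>A \<in> (zero_one_matrices :: (real ^ 'n ^ 'n) set).
    det A \<noteq> 0 \<and> (\<forall>I. \<bar>det A\<bar> / \<mu> * v $ I \<in> \<int>)"
proof -
  obtain f :: "'n \<Rightarrow> 'n set" where f: "inj f" "{I. v $ I \<noteq> 0} \<subseteq> range f"
    "det (\<chi> i j. ind_vec (f j) $ i) \<noteq> (0 :: real)"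
    using independent_ind_vec_extend irreducible_balanced_independent[OF irr \<mu>(1)] \<mu>(2)
    by (metis less_irrefl)
  define A :: "real ^ 'n ^ 'n" where "A = (\<chi> i j. ind_vec (f j) $ i)"
  \<comment> \<open>Dividing by \<open>\<mu>\<close> turns the right-hand side into the all-ones
    vector, so the numerators in Cramer's rule are determinants of integer matrices.\<close>
  define x where "x = (\<chi> j. v $ f j / \<mu>)"
  have detA: "det A \<noteq> 0" using f(3) by (simp add: A_def)
  have A01: "A \<in> zero_one_matrices"
    by (auto simp: A_def zero_one_matrices_def ind_vec_def indicator_def)
  have "(\<Sum>j\<in>UNIV. v $ f j *\<^sub>R ind_vec (f j)) = (\<Sum>I\<in>range f. v $ I *\<^sub>R ind_vec I)"
    using f(1) by (simp add: sum.reindex)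
  also have "\<dots> = \<mu> *\<^sub>R ind_vec UNIV"
    unfolding \<mu>(1)[symmetric] incidence_matrix_mult
    using f(2) by (intro sum.mono_neutral_left) auto
  finally have sum: "(\<Sum>j\<in>UNIV. v $ f j * ind_vec (f j) $ i) = \<mu>" for i
    by (simp add: vec_eq_iff ind_vec_def)
  have "A *v x = ind_vec UNIV"
    using sum \<mu>(2)
    by (simp add: vec_eq_iff matrix_vector_mult_def A_def x_def mult.commute ind_vec_def[of UNIV]
        flip: sum_divide_distrib)
  then have x: "x = (\<chi> k. det (\<chi> i j. if j = k then ind_vec UNIV $ i else A $ i $ j) / det A)"
    using cramer[OF detA] by blast
  have "\<bar>det A\<bar> / \<mu> * v $ I \<in> \<int>" for I
  proof (cases "v $ I = 0")
    case False
    then obtain k where k: "I = f k" using f(2) by blast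
    let ?D = "det (\<chi> i j. if j = k then ind_vec UNIV $ i else A $ i $ j)"
    have "?D \<in> \<int>"
      by (intro det_in_Ints) (auto simp: ind_vec_def A_def indicator_def)
    moreover have "v $ I / \<mu> = ?D / det A"
      using arg_cong[OF x, of "\<lambda>x. x $ k"] by (simp add: x_def k)
    then have "\<bar>det A\<bar> / \<mu> * v $ I = sgn (det A) * ?D"
      using detA by (simp add: field_simps sgn_if)
    moreover have "sgn (det A) \<in> \<int>" by (auto simp: sgn_if)
    ultimately show ?thesis by simp
  qed simp
  then show ?thesis using A01 detA by blast
qed

text \<open>For \<open>\<mu> > 0\<close> the primitive factor is at most
  \<open>\<bar>det A\<bar> / \<mu>\<close>, and multiplying by the row sum \<open>\<mu>\<close>
  cancels the denominator.\<close>

lemma irreducible_balanced_complexity_le_det: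
  fixes v :: "real ^ ('n::finite set)"
  assumes "v \<noteq> 0" and irr: "irreducible_balanced v"
  obtains A :: "real ^ 'n ^ 'n" where "A \<in> zero_one_matrices" "complexity v \<le> \<bar>det A\<bar>"
proof -
  obtain \<mu> where \<mu>: "incidence_matrix *v v = \<mu> *\<^sub>R ind_vec UNIV"
    and nonneg: "\<And>I. 0 \<le> v $ I"
    using irr by (auto simp: irreducible_balanced_def balanced_def)
  have row: "(\<Sum>I\<in>UNIV. v $ I * ind_vec I $ i) = \<mu>" for i
    using arg_cong[OF \<mu>, of "\<lambda>x. x $ i"] unfolding incidence_matrix_mult
    by (simp add: ind_vec_def[of UNIV])
  have terms: "0 \<le> v $ I * ind_vec I $ i" for I i
    by (simp add: nonneg ind_vec_def)
  \<comment> \<open>Any row serves here; \<open>undefined\<close> merely names one.\<close>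
  have "0 \<le> (\<Sum>I\<in>UNIV. v $ I * ind_vec I $ undefined)"
    by (intro sum_nonneg terms)
  then have "\<mu> \<ge> 0" by (simp only: row)
  then consider "\<mu> = 0" | "\<mu> > 0" by linarith
  then show thesis
  proof cases
    case 1
    have zero: "v $ I = 0" if I: "I \<noteq> {}" for I
    proof -
      obtain i where "i \<in> I" using I by blast
      have "v $ I * ind_vec I $ i = 0"
        using row[of i] 1 terms by (simp add: sum_nonneg_eq_0_iff)
      then show ?thesis using \<open>i \<in> I\<close> by (simp add: ind_vec_def)
    qed
    then have "v $ {} \<noteq> 0" using assms(1) by (metis vec_eq_iff zero_index)
    then have pos: "v $ {} > 0" using nonneg[of "{}"] by simp
    have "1 / v $ {} * v $ I \<in> \<int>" for I
      using zero[of I] pos by (cases "I = {}") auto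
    moreover have "1 / v $ {} > 0" using pos by simp
    ultimately obtain c where c: "primitive_multiple v = c *\<^sub>R v"
      using primitive_multiple_eq_scaleR[OF assms(1)] by blast
    have "complexity v = 0"
      using complexity_eq[OF c \<mu>] 1 by simp
    \<comment> \<open>Complexity 0 lies below every absolute determinant, so any 0/1 matrix is a
      witness.\<close>
    moreover have "mat 1 \<in> (zero_one_matrices :: (real ^ 'n ^ 'n) set)"
      by (simp add: zero_one_matrices_def mat_def)
    ultimately show thesis using that[of "mat 1"] by simp
  next
    case 2
    obtain A :: "real ^ 'n ^ 'n" where A: "A \<in> zero_one_matrices" "det A \<noteq> 0"
      "\<And>I. \<bar>det A\<bar> / \<mu> * v $ I \<in> \<int>"
      using irreducible_balanced_scale_integral[OF irr \<mu> 2] by blast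
    have "\<bar>det A\<bar> / \<mu> > 0" using A(2) 2 by simp
    then obtain c where c: "c \<le> \<bar>det A\<bar> / \<mu>" "primitive_multiple v = c *\<^sub>R v"
      using primitive_multiple_eq_scaleR[OF assms(1) _ A(3)] by blast
    have "complexity v = c * \<mu>" using complexity_eq[OF c(2) \<mu>] .
    also have "\<dots> \<le> \<bar>det A\<bar>" using c(1) 2 by (simp add: field_simps)
    finally show thesis using that A(1) by blast
  qed
qed

theorem theorem4p6:
  fixes v :: "real ^ ('n::finite set)" and m :: real
  assumes "v \<noteq> 0"
    and "irreducible_balanced v"
    and "complexity v = m"
  shows "m \<le> Max (det ` (zero_one_matrices :: (real ^ 'n ^ 'n) set)) \<and>
         Max (det ` (zero_one_matrices :: (real ^ 'n ^ 'n) set))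
           \<le> (real CARD('n) + 1) powr ((real CARD('n) + 1) / 2) / 2 ^ CARD('n)"
proof
  obtain A :: "real ^ 'n ^ 'n" where "A \<in> zero_one_matrices" "m \<le> \<bar>det A\<bar>"
    using irreducible_balanced_complexity_le_det[OF assms(1,2)] assms(3) by blast
  then show "m \<le> Max (det ` (zero_one_matrices :: (real ^ 'n ^ 'n) set))"
    using zero_one_matrix_abs_det_le_Max[of A] by linarith
  have "det B \<le> (real CARD('n) + 1) powr ((real CARD('n) + 1) / 2) / 2 ^ CARD('n)"
    if "B \<in> zero_one_matrices" for B :: "real ^ 'n ^ 'n"
    using zero_one_matrix_det_bound[OF that] by linarith
  then show "Max (det ` (zero_one_matrices :: (real ^ 'n ^ 'n) set))
      \<le> (real CARD('n) + 1) powr ((real CARD('n) + 1) / 2) / 2 ^ CARD('n)"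
    \<comment> \<open>\<open>A\<close> witnesses that the set under \<open>Max\<close> is
      nonempty.\<close>
    using \<open>A \<in> zero_one_matrices\<close> by (subst Max_le_iff) (auto simp: finite_zero_one_matrices)
qed

end
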